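(* Let $k\ge 1$ be an integer. There is exactly one value $a_k^*\in(0,1)$ of the parameter $a$ satisfying $$\frac{\sqrt{a}}{2k}\cdot\frac{(1+\sqrt a)^{2k}+(1-\sqrt a)^{2k}}{(1+\sqrt a)^{2k}-(1-\sqrt a)^{2k}}=\frac{4}{\left[\left(\frac{1+\sqrt a}{1-\sqrt a}\right)^k+\left(\frac{1-\sqrt a}{1+\sqrt a}\right)^k\right]^2-4},$$ and $a_k^*$ is the optimal choice of $a$ for the problem $$\min_{a\in[0,1)}\ \sup_{x\in(0,1]} x\left|1-\frac{1}{1-\tau_k^{[a,1]}(x)^2}\right|,$$ i.e. the minimum is attained at $a=a_k^*$. Moreover, $\sqrt{a_k^*}$ is the only root in $(0,1)$ of the polynomial equation $$8k(1-x^2)^{2k}+x\left[(1-x)^{4k}-(1+x)^{4k}\right]=0.$$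
   Context: $\tau_k$ denotes the Chebyshev polynomial of the first kind of degree $k$: $\tau_0(x)=1$, $\tau_1(x)=x$, $\tau_{k+1}(x)=2x\,\tau_k(x)-\tau_{k-1}(x)$. For $a\in[0,1)$, the scaled and shifted Chebyshev polynomial on $[a,1]$ is $$\tau_k^{[a,1]}(x)=\tau_k\left(\frac{1+a-2x}{1-a}\right)\Big/\tau_k\left(\frac{1+a}{1-a}\right),$$ so that $\tau_k^{[a,1]}(0)=1$. The objective $x\left|1-\frac{1}{1-\tau_k^{[a,1]}(x)^2}\right|=\frac{x\,\tau_k^{[a,1]}(x)^2}{|1-\tau_k^{[a,1]}(x)^2|}$ is taken to be $+\infty$ at points $x\in(0,1]$ where $\tau_k^{[a,1]}(x)^2=1$ (this occurs only for $a=0$). *)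

theory Defs
  imports "HOL-Analysis.Analysis" "HOL-Computational_Algebra.Polynomial"
begin

fun cheb_poly :: "nat \<Rightarrow> real poly" where
  "cheb_poly 0 = 1"
| "cheb_poly (Suc 0) = [:0, 1:]"
| "cheb_poly (Suc (Suc k)) = 2 * [:0, 1:] * cheb_poly (Suc k) - cheb_poly k"

definition scaled_cheb :: "nat \<Rightarrow> real \<Rightarrow> real \<Rightarrow> real" where
  "scaled_cheb k a x =
     poly (cheb_poly k) ((1 + a - 2 * x) / (1 - a)) / poly (cheb_poly k) ((1 + a) / (1 - a))"

(* Without the case distinction, division by zero would make the value x instead of infinity. *)
definition smoothing_objective :: "nat \<Rightarrow> real \<Rightarrow> real \<Rightarrow> ereal" where
  "smoothing_objective k a x =
     (if (scaled_cheb k a x)^2 = 1 then \<infinity>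
      else ereal (x * \<bar>1 - 1 / (1 - (scaled_cheb k a x)^2)\<bar>))"

definition worst_case :: "nat \<Rightarrow> real \<Rightarrow> ereal" where
  "worst_case k a = (SUP x\<in>{0<..1}. smoothing_objective k a x)"

end

theory Submission
  imports Defs
begin

text \<open>
  Put \<open>a = tanh\<^sup>2 u\<close> with \<open>u > 0\<close>. Then \<open>(1 + a) / (1 - a) = cosh 2u\<close>, so the
  normalising constant \<open>\<tau>\<^sub>k((1 + a) / (1 - a))\<close> is \<open>C = cosh 2ku\<close>, and the objective is
  \<open>x T\<^sup>2 / (C\<^sup>2 - T\<^sup>2)\<close>, where \<open>T\<close> is the value of \<open>\<tau>\<^sub>k\<close> at
  \<open>y = cosh 2u - 2 x cosh\<^sup>2 u\<close>.

  On \<open>[a, 1]\<close> one has \<open>\<bar>y\<bar> \<le> 1\<close>, hence \<open>T\<^sup>2 \<le> 1\<close>, and the maximum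
  \<open>R(u) = 1 / sinh\<^sup>2 2ku\<close> is taken at \<open>x = 1\<close>, where \<open>y = -1\<close>. On \<open>(0, a)\<close> one has
  \<open>y > 1\<close>, and the objective is a negative constant divided by the slope of the chord of \<open>1 / \<tau>\<^sub>k\<^sup>2\<close>
  between \<open>y\<close> and \<open>cosh 2u\<close>. That function is convex on \<open>[1, \<infinity>)\<close>, so the supremum is the limit
  at \<open>x = 0\<close>, in which the chord becomes the tangent; it equals
  \<open>L(u) = tanh u / (2k tanh 2ku)\<close>. The worst case is therefore \<open>max (L u) (R u)\<close>
  (\<open>worst_case_le\<close>, \<open>worst_case_ge_endpoint\<close>, \<open>worst_case_ge_origin\<close>).

  Clearly \<open>R\<close> decreases, and \<open>L\<close> increases by \<open>tanh_quotient_mono\<close>, so the maximum is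
  smallest where the two curves meet. They meet exactly where
  \<open>tanh u * sinh 4ku = 4k\<close>; the left-hand side increases strictly from 0 to infinity, so this
  happens once. Both equations of the theorem are this balance equation, rewritten through
  \<open>1 + tanh u = exp u / cosh u\<close> and \<open>1 - tanh u = exp (-u) / cosh u\<close>.

  The monotonicity of \<open>tanh u / tanh nu\<close> is used twice: with \<open>n = 2k\<close> it makes \<open>L\<close>
  monotone, and with \<open>n = k\<close> it gives the convexity behind the bound on \<open>(0, a)\<close>.
\<close>

section \<open>Monotone quotients of hyperbolic functions\<close>

text \<open>
  The quotient \<open>Q\<^sub>n(x) = sinh nx / sinh x\<close> satisfies
  \<open>Q\<^sub>n\<^sub>+\<^sub>1 = Q\<^sub>n cosh x + cosh nx\<close>, which has only increasing ingredients.
\<close>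

lemma sinh_multiple_quotient_mono:
  fixes v w :: real
  assumes "0 < v" "v \<le> w"
  shows "sinh (real n * v) / sinh v \<le> sinh (real n * w) / sinh w"
proof (induction n)
  case 0
  show ?case by simp
next
  case (Suc n)
  have step: "sinh (real (Suc n) * x) / sinh x = sinh (real n * x) / sinh x * cosh x + cosh (real n * x)"
    if "0 < x" for x :: real
    using that by (simp add: sinh_add distrib_right field_simps)
  have "sinh (real n * v) / sinh v * cosh v \<le> sinh (real n * w) / sinh w * cosh w"
    using Suc.IH assms by (intro mult_mono) (auto simp: cosh_real_nonneg_le_iff)
  moreover have "cosh (real n * v) \<le> cosh (real n * w)"
    using assms by (subst cosh_real_nonneg_le_iff) (auto intro: mult_left_mono)
  ultimately show ?case
    using assms by (simp only: step)
qed

text \<open>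
  Clearing denominators and turning products into sums, the claim becomes
  \<open>sinh (n(v - u)) / sinh (v - u) \<le> sinh (n(u + v)) / sinh (u + v)\<close>.
\<close>

lemma tanh_quotient_mono:
  fixes u v :: real
  assumes "0 < u" "u \<le> v"
  shows "tanh u / tanh (real n * u) \<le> tanh v / tanh (real n * v)"
proof (cases "n = 0 \<or> u = v")
  case True
  then show ?thesis by auto
next
  case False
  then have n: "n > 0" and uv: "u < v" using assms by auto
  define S D Sn Dn where "S = sinh (u + v)" and "D = sinh (v - u)"
    and "Sn = sinh (real n * (u + v))" and "Dn = sinh (real n * (v - u))"
  have pos: "0 < S" "0 < D" using assms uv by (auto simp: S_def D_def)
  have "Dn / D \<le> Sn / S"
    unfolding S_def D_def Sn_def Dn_def
    by (rule sinh_multiple_quotient_mono) (use assms uv in auto)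
  then have key: "S * Dn \<le> D * Sn"
    using pos by (simp add: field_simps)
  have prods: "2 * (sinh u * cosh v) = S - D" "2 * (sinh v * cosh u) = S + D"
    "2 * (sinh (real n * v) * cosh (real n * u)) = Sn + Dn"
    "2 * (sinh (real n * u) * cosh (real n * v)) = Sn - Dn"
    by (auto simp: S_def D_def Sn_def Dn_def sinh_add sinh_diff distrib_left right_diff_distrib)
  have "(2 * (sinh u * cosh v)) * (2 * (sinh (real n * v) * cosh (real n * u)))
      \<le> (2 * (sinh v * cosh u)) * (2 * (sinh (real n * u) * cosh (real n * v)))"
    unfolding prods using key by (simp add: algebra_simps)
  then have "(sinh u * cosh (real n * u)) * (cosh v * sinh (real n * v))
      \<le> (sinh v * cosh (real n * v)) * (cosh u * sinh (real n * u))"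
    by (simp add: mult_ac)
  moreover have "0 < cosh u * sinh (real n * u)" "0 < cosh v * sinh (real n * v)"
    using assms n by auto
  ultimately show ?thesis
    by (simp add: tanh_def frac_le_eq divide_simps mult_ac)
qed

text \<open>
  In the variables \<open>y = cosh \<phi>\<close> and \<open>y\<^sub>0 = cosh \<theta>\<close> this says that the graph of
  \<open>1 / \<tau>\<^sub>k(y)\<^sup>2\<close>, which is \<open>1 / cosh\<^sup>2 k\<phi>\<close>, lies above its tangent at \<open>y\<^sub>0\<close>. Working in
  \<open>\<phi>\<close> avoids the derivative of the polynomial: the difference to the tangent vanishes at \<open>\<theta>\<close>
  and decreases before, because \<open>tanh k\<phi> / (sinh \<phi> cosh\<^sup>2 k\<phi>)\<close> decreases. Indeed
  \<open>tanh k\<phi> / sinh \<phi>\<close> is the reciprocal of \<open>(tanh \<phi> / tanh k\<phi>) cosh \<phi>\<close>, a product of increasing functions.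
\<close>

lemma inverse_cosh_sq_tangent_bound:
  fixes \<phi> \<theta> :: real
  assumes "k \<ge> 1" "0 \<le> \<phi>" "\<phi> < \<theta>"
  shows "2 * real k * tanh (real k * \<theta>) * (cosh \<theta> - cosh \<phi>) * cosh (real k * \<phi>)^2
    \<le> sinh \<theta> * (cosh (real k * \<theta>)^2 - cosh (real k * \<phi>)^2)"
proof -
  \<comment> \<open>minus the slope of the tangent at \<open>cosh \<theta>\<close>, as a function of \<open>cosh\<close>\<close>
  define c where "c = 2 * real k * tanh (real k * \<theta>) / (sinh \<theta> * cosh (real k * \<theta>)^2)"
  define H where "H t = 1 / cosh (real k * t)^2 + c * cosh t" for t :: real
  define H' where "H' t = c * sinh t - 2 * real k * tanh (real k * t) / cosh (real k * t)^2" for t :: real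
  have \<theta>: "\<theta> > 0" using assms by linarith
  have der: "(H has_real_derivative H' t) (at t)" for t
    unfolding H_def H'_def
    by (auto intro!: derivative_eq_intros simp: tanh_def field_simps power2_eq_square)
  have nonpos: "H' t \<le> 0" if t: "0 < t" "t \<le> \<theta>" for t
  proof -
    have kt: "0 < real k * t" "0 < real k * \<theta>" "real k * t \<le> real k * \<theta>"
      using t \<theta> assms(1) by auto
    have "sinh t / tanh (real k * t) = tanh t / tanh (real k * t) * cosh t"
      by (simp add: tanh_def)
    also have "\<dots> \<le> tanh \<theta> / tanh (real k * \<theta>) * cosh \<theta>"
      using t \<theta> assms(1) tanh_quotient_mono[OF t, of k]
      by (intro mult_mono) (auto simp: cosh_real_nonneg_le_iff)
    also have "\<dots> = sinh \<theta> / tanh (real k * \<theta>)"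
      by (simp add: tanh_def)
    finally have 1: "tanh (real k * \<theta>) * sinh t \<le> tanh (real k * t) * sinh \<theta>"
      using kt by (simp add: field_simps)
    have 2: "cosh (real k * t)^2 \<le> cosh (real k * \<theta>)^2"
      using kt by (intro power_mono) (auto simp: cosh_real_nonneg_le_iff)
    have "(tanh (real k * \<theta>) * sinh t) * cosh (real k * t)^2
        \<le> (tanh (real k * t) * sinh \<theta>) * cosh (real k * \<theta>)^2"
      by (rule mult_mono[OF 1 2]) (use t \<theta> kt in auto)
    then have "tanh (real k * \<theta>) * sinh t / (sinh \<theta> * cosh (real k * \<theta>)^2)
        \<le> tanh (real k * t) / cosh (real k * t)^2"
      using \<theta> by (simp add: divide_simps mult_ac)
    then have "2 * real k * (tanh (real k * \<theta>) * sinh t / (sinh \<theta> * cosh (real k * \<theta>)^2))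
        \<le> 2 * real k * (tanh (real k * t) / cosh (real k * t)^2)"
      by (intro mult_left_mono) auto
    then show ?thesis
      unfolding H'_def c_def by (simp add: mult_ac)
  qed
  have "H \<theta> \<le> H \<phi>"
  proof (rule DERIV_nonpos_imp_decreasing_open[of \<phi> \<theta>])
    show "\<phi> \<le> \<theta>" using assms by simp
    show "\<exists>y. (H has_real_derivative y) (at x) \<and> y \<le> 0" if "\<phi> < x" "x < \<theta>" for x
      using der[of x] nonpos[of x] that assms by auto
    show "continuous_on {\<phi>..\<theta>} H"
      using der DERIV_isCont by (metis continuous_at_imp_continuous_on)
  qed
  then have "c * (cosh \<theta> - cosh \<phi>) \<le> 1 / cosh (real k * \<phi>)^2 - 1 / cosh (real k * \<theta>)^2"
    by (simp add: H_def algebra_simps)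
  then have "c * (cosh \<theta> - cosh \<phi>) * (sinh \<theta> * cosh (real k * \<theta>)^2 * cosh (real k * \<phi>)^2)
     \<le> (1 / cosh (real k * \<phi>)^2 - 1 / cosh (real k * \<theta>)^2) * (sinh \<theta> * cosh (real k * \<theta>)^2 * cosh (real k * \<phi>)^2)"
    by (rule mult_right_mono) (use \<theta> in auto)
  also have "\<dots> = sinh \<theta> * (cosh (real k * \<theta>)^2 - cosh (real k * \<phi>)^2)"
    by (simp add: field_simps)
  also have "c * (cosh \<theta> - cosh \<phi>) * (sinh \<theta> * cosh (real k * \<theta>)^2 * cosh (real k * \<phi>)^2)
     = 2 * real k * tanh (real k * \<theta>) * (cosh \<theta> - cosh \<phi>) * cosh (real k * \<phi>)^2"
    using \<theta> by (simp add: c_def)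
  finally show ?thesis .
qed

lemma frac_le_cross:
  fixes p q r s :: real
  assumes "p * s \<le> r * q" "0 < q" "0 < s"
  shows "p / q \<le> r / s"
  using assms by (simp add: field_simps)

section \<open>The objective in hyperbolic coordinates\<close>

lemma cheb_poly_cos: "poly (cheb_poly k) (cos t) = cos (real k * t)"
proof (induction k rule: cheb_poly.induct)
  case (3 k)
  have "cos (m + t) + cos (m - t) = 2 * cos t * cos m" for m
    by (simp add: cos_add cos_diff)
  from this[of "real (Suc k) * t"]
  have "cos (real (Suc (Suc k)) * t) + cos (real k * t) = 2 * cos t * cos (real (Suc k) * t)"
    by (simp add: distrib_right)
  with 3 show ?case by (simp del: of_nat_Suc)
qed auto

lemma cheb_poly_cosh: "poly (cheb_poly k) (cosh t) = cosh (real k * t)"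
proof (induction k rule: cheb_poly.induct)
  case (3 k)
  have "cosh (m + t) + cosh (m - t) = 2 * cosh t * cosh m" for m
    by (simp add: cosh_add cosh_diff)
  from this[of "real (Suc k) * t"]
  have "cosh (real (Suc (Suc k)) * t) + cosh (real k * t) = 2 * cosh t * cosh (real (Suc k) * t)"
    by (simp add: distrib_right)
  with 3 show ?case by (simp del: of_nat_Suc)
qed auto

lemma cheb_poly_bounded:
  assumes "\<bar>y\<bar> \<le> 1"
  shows "(poly (cheb_poly k) y)^2 \<le> 1"
proof -
  have "poly (cheb_poly k) y = cos (real k * arccos y)"
    using assms by (metis cheb_poly_cos cos_arccos_abs)
  then show ?thesis by (simp add: abs_square_le_1)
qed

lemma one_minus_tanh_sq: "1 - tanh u ^ 2 = 1 / cosh u ^ 2" for u :: real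
  by (simp add: tanh_def power_divide field_simps sinh_square_eq)

lemma scaled_cheb_tanh:
  fixes u :: real
  shows "scaled_cheb k (tanh u ^ 2) x
    = poly (cheb_poly k) (cosh (2 * u) - 2 * x * cosh u ^ 2) / cosh (real k * (2 * u))"
proof -
  have "(1 + tanh u ^ 2 - 2 * x) / (1 - tanh u ^ 2) = cosh (2 * u) - 2 * x * cosh u ^ 2" for x
    by (simp add: one_minus_tanh_sq cosh_double) (simp add: tanh_def field_simps)
  from this this[of 0] show ?thesis
    by (simp add: scaled_cheb_def cheb_poly_cosh)
qed

lemma smoothing_objective_eq:
  assumes "scaled_cheb k a x = T / C" "T^2 < C^2" "0 \<le> x"
  shows "smoothing_objective k a x = ereal (x * T^2 / (C^2 - T^2))"
proof -
  have C: "C \<noteq> 0" and "C^2 > 0" using assms(2) by (auto simp: zero_less_power2)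
  have lt: "(T / C)^2 < 1"
    using assms(2) \<open>C^2 > 0\<close> by (simp add: power_divide)
  have "1 - 1 / (1 - (T / C)^2) = - (T^2 / (C^2 - T^2))"
    using C assms(2) by (simp add: power_divide field_simps)
  moreover have "0 \<le> T^2 / (C^2 - T^2)" using assms(2) by simp
  ultimately show ?thesis
    using lt assms by (simp add: smoothing_objective_def)
qed

text \<open>
  The points \<open>x \<in> (0, a]\<close> are parametrised by \<open>0 \<le> \<phi> < 2u\<close>: there the argument of
  \<open>\<tau>\<^sub>k\<close> is \<open>cosh \<phi>\<close>.
\<close>

lemma objective_outside:
  fixes u \<phi> :: real
  assumes "k \<ge> 1" "0 \<le> \<phi>" "\<phi> < 2 * u"
  defines "x \<equiv> (cosh (2 * u) - cosh \<phi>) / (2 * cosh u ^ 2)"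
  shows "smoothing_objective k (tanh u ^ 2) x
    = ereal (x * cosh (real k * \<phi>)^2 / (cosh (real k * (2 * u))^2 - cosh (real k * \<phi>)^2))"
proof (rule smoothing_objective_eq)
  show "scaled_cheb k (tanh u ^ 2) x = cosh (real k * \<phi>) / cosh (real k * (2 * u))"
  proof -
    have "cosh (2 * u) - 2 * x * cosh u ^ 2 = cosh \<phi>"
      by (simp add: x_def field_simps)
    then show ?thesis
      by (simp add: scaled_cheb_tanh cheb_poly_cosh)
  qed
  have "real k * \<phi> < real k * (2 * u)" using assms by simp
  then show "cosh (real k * \<phi>)^2 < cosh (real k * (2 * u))^2"
    using assms by (intro power_strict_mono) (auto simp: cosh_real_nonneg_less_iff)
  show "0 \<le> x"
    using assms by (auto simp: x_def cosh_real_nonneg_le_iff)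
qed

lemma objective_outside_le:
  fixes u \<phi> :: real
  assumes "k \<ge> 1" "0 \<le> \<phi>" "\<phi> < 2 * u"
  shows "smoothing_objective k (tanh u ^ 2) ((cosh (2 * u) - cosh \<phi>) / (2 * cosh u ^ 2))
    \<le> ereal (tanh u / (2 * real k * tanh (real (2 * k) * u)))"
proof -
  define T2 where "T2 = cosh (real k * \<phi>)^2"
  define C2 where "C2 = cosh (real k * (2 * u))^2"
  have u: "u > 0" and k: "real k > 0" using assms by auto
  have "real k * \<phi> < real k * (2 * u)" using assms by simp
  then have lt: "T2 < C2" unfolding T2_def C2_def
    using assms by (intro power_strict_mono) (auto simp: cosh_real_nonneg_less_iff)
  have tpos: "0 < tanh (real k * (2 * u))" using u k by simp
  have "2 * real k * tanh (real k * (2 * u)) * (cosh (2 * u) - cosh \<phi>) * T2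
      \<le> (2 * sinh u * cosh u) * (C2 - T2)"
    using inverse_cosh_sq_tangent_bound[OF assms] by (simp add: T2_def C2_def sinh_double)
  then have "(cosh (2 * u) - cosh \<phi>) * T2 / (C2 - T2)
      \<le> 2 * sinh u * cosh u / (2 * real k * tanh (real k * (2 * u)))"
    using lt tpos k by (intro frac_le_cross) (simp_all add: mult_ac)
  then have "((cosh (2 * u) - cosh \<phi>) * T2 / (C2 - T2)) / (2 * cosh u ^ 2)
      \<le> (2 * sinh u * cosh u / (2 * real k * tanh (real k * (2 * u)))) / (2 * cosh u ^ 2)"
    by (rule divide_right_mono) simp
  also have "\<dots> = tanh u / (2 * real k * tanh (real (2 * k) * u))"
    by (simp add: tanh_def[of u] power2_eq_square mult_ac)
  finally show ?thesis
    unfolding objective_outside[OF assms] T2_def[symmetric] C2_def[symmetric]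
    by (simp add: mult_ac)
qed

lemma objective_inside_le:
  fixes u x :: real
  assumes "k \<ge> 1" "0 < u" "tanh u ^ 2 \<le> x" "x \<le> 1"
  shows "smoothing_objective k (tanh u ^ 2) x \<le> ereal (1 / sinh (real (2 * k) * u)^2)"
proof -
  define T where "T = poly (cheb_poly k) (cosh (2 * u) - 2 * x * cosh u ^ 2)"
  define C where "C = cosh (real k * (2 * u))"
  have s: "sinh (real (2 * k) * u)^2 = C^2 - 1"
    by (simp add: C_def sinh_square_eq mult_ac)
  have "0 < sinh (real (2 * k) * u)" using assms by simp
  then have C: "1 < C^2" using s by (metis diff_gt_0_iff_gt zero_less_power)
  have x0: "0 \<le> x" using assms(3) by (meson order_trans zero_le_power2)
  have "tanh u ^ 2 * cosh u ^ 2 \<le> x * cosh u ^ 2" "x * cosh u ^ 2 \<le> 1 * cosh u ^ 2"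
    using assms by (intro mult_right_mono; simp)+
  then have "sinh u ^ 2 \<le> x * cosh u ^ 2" "x * cosh u ^ 2 \<le> cosh u ^ 2"
    by (simp_all add: tanh_def power_divide)
  then have "\<bar>cosh (2 * u) - 2 * x * cosh u ^ 2\<bar> \<le> 1"
    unfolding cosh_double using hyperbolic_pythagoras[of u] by linarith
  then have T: "T^2 \<le> 1" unfolding T_def by (rule cheb_poly_bounded)
  have "smoothing_objective k (tanh u ^ 2) x = ereal (x * T^2 / (C^2 - T^2))"
    by (rule smoothing_objective_eq) (use T C x0 in \<open>auto simp: scaled_cheb_tanh T_def C_def\<close>)
  moreover have "x * T^2 / (C^2 - T^2) \<le> 1 * 1 / (C^2 - 1)"
    using T C x0 assms by (intro frac_le mult_mono) auto
  ultimately show ?thesis unfolding s by simp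
qed

lemma worst_case_le:
  fixes u :: real
  assumes "k \<ge> 1" "0 < u"
  shows "worst_case k (tanh u ^ 2)
    \<le> max (ereal (tanh u / (2 * real k * tanh (real (2 * k) * u))))
          (ereal (1 / sinh (real (2 * k) * u)^2))"
  unfolding worst_case_def
proof (rule SUP_least)
  fix x :: real assume x: "x \<in> {0<..1}"
  show "smoothing_objective k (tanh u ^ 2) x
    \<le> max (ereal (tanh u / (2 * real k * tanh (real (2 * k) * u))))
          (ereal (1 / sinh (real (2 * k) * u)^2))"
  proof (cases "tanh u ^ 2 \<le> x")
    case True
    then show ?thesis using objective_inside_le[OF assms, of x] x by (auto simp: le_max_iff_disj)
  next
    case False
    define \<phi> where "\<phi> = arcosh (cosh (2 * u) - 2 * x * cosh u ^ 2)"
    have "x * cosh u ^ 2 < tanh u ^ 2 * cosh u ^ 2"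
      using False by (intro mult_strict_right_mono) auto
    then have "x * cosh u ^ 2 < sinh u ^ 2" by (simp add: tanh_def power_divide)
    then have y: "1 \<le> cosh (2 * u) - 2 * x * cosh u ^ 2"
      unfolding cosh_double using hyperbolic_pythagoras[of u] by linarith
    have c: "cosh \<phi> = cosh (2 * u) - 2 * x * cosh u ^ 2" "0 \<le> \<phi>"
      using y by (auto simp: \<phi>_def)
    have "0 < x * cosh u ^ 2" using x by simp
    then have "cosh \<phi> < cosh (2 * u)" using c by simp
    then have "\<phi> < 2 * u" using c(2) assms cosh_real_nonneg_less_iff[of \<phi> "2 * u"] by linarith
    moreover have "(cosh (2 * u) - cosh \<phi>) / (2 * cosh u ^ 2) = x"
      by (simp add: c)
    ultimately show ?thesis
      using objective_outside_le[OF assms(1) c(2)] by (auto simp: le_max_iff_disj)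
  qed
qed

lemma worst_case_ge_endpoint:
  fixes u :: real
  assumes "k \<ge> 1" "0 < u"
  shows "ereal (1 / sinh (real (2 * k) * u)^2) \<le> worst_case k (tanh u ^ 2)"
proof -
  define T where "T = poly (cheb_poly k) (-1)"
  define C where "C = cosh (real k * (2 * u))"
  have "T = cos (real k * pi)"
    using cheb_poly_cos[of k pi] by (simp add: T_def)
  then have T: "T^2 = 1" by (auto simp: cos_npi simp flip: power_mult)
  have s: "sinh (real (2 * k) * u)^2 = C^2 - 1"
    by (simp add: C_def sinh_square_eq mult_ac)
  have "0 < sinh (real (2 * k) * u)" using assms by simp
  then have C: "1 < C^2" using s by (metis diff_gt_0_iff_gt zero_less_power)
  have y: "cosh (2 * u) - 2 * 1 * cosh u ^ 2 = -1"
    unfolding cosh_double using hyperbolic_pythagoras[of u] by linarith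
  have "smoothing_objective k (tanh u ^ 2) 1 = ereal (1 * T^2 / (C^2 - T^2))"
    using C T scaled_cheb_tanh[of k u 1] unfolding y
    by (intro smoothing_objective_eq) (auto simp: T_def C_def)
  also have "\<dots> = ereal (1 / sinh (real (2 * k) * u)^2)" unfolding T s by simp
  finally show ?thesis
    unfolding worst_case_def by (metis SUP_upper greaterThanAtMost_iff order_refl zero_less_one)
qed

text \<open>
  As \<open>\<phi>\<close> tends to \<open>\<theta> = 2u\<close> from the left, that is, as \<open>x\<close> tends to 0, the objective
  is a quotient of difference quotients at \<open>\<theta>\<close>. Its limit is a lower bound for the supremum,
  although it is not attained.
\<close>

lemma worst_case_ge_origin:
  fixes u :: real
  assumes "k \<ge> 1" "0 < u"
  shows "ereal (tanh u / (2 * real k * tanh (real (2 * k) * u))) \<le> worst_case k (tanh u ^ 2)"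
proof -
  define \<theta> where "\<theta> = 2 * u"
  define X where "X \<phi> = (cosh \<theta> - cosh \<phi>) / (2 * cosh u ^ 2)" for \<phi> :: real
  define f where "f \<phi> = X \<phi> * cosh (real k * \<phi>)^2 / (cosh (real k * \<theta>)^2 - cosh (real k * \<phi>)^2)" for \<phi> :: real
  have \<theta>: "\<theta> > 0" and k: "real k > 0" using assms by (auto simp: \<theta>_def)
  have ev: "\<forall>\<^sub>F \<phi> in at_left \<theta>. \<phi> \<in> {0<..<\<theta>}"
    using \<theta> by (rule eventually_at_left_real)
  have le: "ereal (f \<phi>) \<le> worst_case k (tanh u ^ 2)" if "\<phi> \<in> {0<..<\<theta>}" for \<phi>
  proof -
    have "smoothing_objective k (tanh u ^ 2) (X \<phi>) = ereal (f \<phi>)"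
      using objective_outside[OF assms(1), of \<phi> u] that by (simp add: f_def X_def \<theta>_def)
    moreover have "X \<phi> \<in> {0<..1}"
    proof -
      have "cosh \<phi> < cosh \<theta>" using that by (simp add: cosh_real_nonneg_less_iff)
      moreover have "cosh \<theta> - cosh \<phi> \<le> 2 * cosh u ^ 2"
        using cosh_double_cosh[of u] cosh_real_ge_1[of \<phi>] unfolding \<theta>_def by linarith
      ultimately show ?thesis by (simp add: X_def)
    qed
    ultimately show ?thesis unfolding worst_case_def by (metis SUP_upper)
  qed
  have d1: "(cosh has_real_derivative sinh \<theta>) (at \<theta> within {..<\<theta>})"
    by (auto intro!: derivative_eq_intros)
  have d2: "((\<lambda>t. cosh (real k * t)^2) has_real_derivative
      2 * real k * cosh (real k * \<theta>) * sinh (real k * \<theta>)) (at \<theta> within {..<\<theta>})"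
    by (auto intro!: derivative_eq_intros)
  have "((\<lambda>\<phi>. ((cosh \<phi> - cosh \<theta>) / (\<phi> - \<theta>)) /
        ((cosh (real k * \<phi>)^2 - cosh (real k * \<theta>)^2) / (\<phi> - \<theta>)) * cosh (real k * \<phi>)^2 / (2 * cosh u ^ 2))
      \<longlongrightarrow> sinh \<theta> / (2 * real k * cosh (real k * \<theta>) * sinh (real k * \<theta>)) * cosh (real k * \<theta>)^2 / (2 * cosh u ^ 2))
      (at_left \<theta>)"
    using k \<theta> d1 d2 unfolding has_field_derivative_iff
    by (intro tendsto_intros) auto
  moreover have "\<forall>\<^sub>F \<phi> in at_left \<theta>. ((cosh \<phi> - cosh \<theta>) / (\<phi> - \<theta>)) /
        ((cosh (real k * \<phi>)^2 - cosh (real k * \<theta>)^2) / (\<phi> - \<theta>)) * cosh (real k * \<phi>)^2 / (2 * cosh u ^ 2) = f \<phi>"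
    using ev
  proof eventually_elim
    case (elim \<phi>)
    have "((cosh \<phi> - cosh \<theta>) / (\<phi> - \<theta>)) / ((cosh (real k * \<phi>)^2 - cosh (real k * \<theta>)^2) / (\<phi> - \<theta>))
      = (cosh \<phi> - cosh \<theta>) / (cosh (real k * \<phi>)^2 - cosh (real k * \<theta>)^2)"
      using elim by simp
    also have "\<dots> = (cosh \<theta> - cosh \<phi>) / (cosh (real k * \<theta>)^2 - cosh (real k * \<phi>)^2)"
      by (metis minus_diff_eq minus_divide_divide)
    finally show ?case by (simp add: f_def X_def)
  qed
  moreover have "sinh \<theta> / (2 * real k * cosh (real k * \<theta>) * sinh (real k * \<theta>)) * cosh (real k * \<theta>)^2 / (2 * cosh u ^ 2)
     = tanh u / (2 * real k * tanh (real (2 * k) * u))"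
    unfolding \<theta>_def sinh_double by (simp add: tanh_def power2_eq_square mult_ac)
  ultimately have "(f \<longlongrightarrow> tanh u / (2 * real k * tanh (real (2 * k) * u))) (at_left \<theta>)"
    by (simp add: tendsto_cong)
  then have "((\<lambda>\<phi>. ereal (f \<phi>)) \<longlongrightarrow> ereal (tanh u / (2 * real k * tanh (real (2 * k) * u)))) (at_left \<theta>)"
    by (rule tendsto_ereal)
  then show ?thesis
    by (rule tendsto_upperbound) (use ev le in \<open>auto elim: eventually_mono\<close>)
qed

text \<open>
  For \<open>a = 0\<close> the normalising constant is 1, and the denominator vanishes at \<open>x = 1\<close>.
\<close>

lemma worst_case_zero: "worst_case k 0 = \<infinity>"
proof -
  have "poly (cheb_poly k) (-1) = cos (real k * pi)"
    using cheb_poly_cos[of k pi] by simp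
  moreover have "poly (cheb_poly k) 1 = 1"
    using cheb_poly_cos[of k 0] by simp
  ultimately have "(scaled_cheb k 0 1)^2 = 1"
    by (auto simp: scaled_cheb_def cos_npi simp flip: power_mult)
  then have "smoothing_objective k 0 1 = \<infinity>" by (simp add: smoothing_objective_def)
  then show ?thesis
    unfolding worst_case_def
    by (metis SUP_upper ereal_infty_less_eq(1) greaterThanAtMost_iff order_refl zero_less_one)
qed

section \<open>The balance equation\<close>

lemma one_plus_minus_tanh:
  fixes u :: real
  shows "1 + tanh u = exp u / cosh u" "1 - tanh u = exp (- u) / cosh u"
  by (simp_all add: tanh_def field_simps cosh_plus_sinh cosh_minus_sinh)

text \<open>
  The polynomial is \<open>8k - 2 tanh u sinh 4ku\<close>, up to the factor \<open>1 / cosh u ^ (4 * k)\<close>.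
\<close>

lemma polynomial_iff_balance:
  fixes u :: real
  shows "8 * real k * (1 - tanh u ^ 2)^(2*k) + tanh u * ((1 - tanh u)^(4*k) - (1 + tanh u)^(4*k)) = 0
     \<longleftrightarrow> tanh u * sinh (real (4 * k) * u) = 4 * real k"
proof -
  have "8 * real k * (1 - tanh u ^ 2)^(2*k) + tanh u * ((1 - tanh u)^(4*k) - (1 + tanh u)^(4*k))
    = (8 * real k - 2 * (tanh u * sinh (real (4 * k) * u))) / cosh u ^ (4*k)"
    unfolding one_minus_tanh_sq one_plus_minus_tanh sinh_field_def
    by (simp add: power_divide diff_divide_distrib right_diff_distrib
        flip: power_mult exp_of_nat_mult)
  then show ?thesis by auto
qed

lemma crossing_iff_balance:
  fixes u :: real
  assumes "k \<ge> 1" "0 < u"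
  shows "tanh u / (2 * real k * tanh (real (2 * k) * u)) = 1 / sinh (real (2 * k) * u)^2
     \<longleftrightarrow> tanh u * sinh (real (4 * k) * u) = 4 * real k"
proof -
  have "sinh (real (4 * k) * u) = 2 * sinh (real (2 * k) * u) * cosh (real (2 * k) * u)"
    using sinh_double[of "real (2 * k) * u"] by (simp add: mult_ac)
  moreover have "0 < sinh (real (2 * k) * u)" "0 < cosh (real (2 * k) * u)"
    using assms by simp_all
  moreover have "tanh u / (2 * real k * (S / C)) = 1 / S^2 \<longleftrightarrow> tanh u * (2 * S * C) = 4 * real k"
    if "0 < S" "0 < C" for S C
    using that assms by (simp add: divide_simps power2_eq_square) (auto simp: mult_ac)
  ultimately show ?thesis by (simp only: tanh_def[of "real (2 * k) * u"])
qed

lemma quotient_power_tanh: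
  fixes u :: real
  shows "((1 + tanh u)^(2*k) + (1 - tanh u)^(2*k)) / ((1 + tanh u)^(2*k) - (1 - tanh u)^(2*k))
      = 1 / tanh (real (2 * k) * u)"
proof -
  define p q where "p = exp (real (2 * k) * u)" and "q = exp (- (real (2 * k) * u))"
  have "(1 + tanh u)^(2*k) = p / cosh u ^ (2*k)" "(1 - tanh u)^(2*k) = q / cosh u ^ (2*k)"
    by (simp_all add: one_plus_minus_tanh power_divide p_def q_def flip: exp_of_nat_mult)
  then have "((1 + tanh u)^(2*k) + (1 - tanh u)^(2*k)) / ((1 + tanh u)^(2*k) - (1 - tanh u)^(2*k))
      = (p + q) / (p - q)"
    by (simp flip: add_divide_distrib diff_divide_distrib)
  also have "\<dots> = 1 / (((p - q) / 2) / ((p + q) / 2))"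
  proof -
    have "r / t = 1 / ((t / 2) / (r / 2))" for r t :: real by simp
    then show ?thesis .
  qed
  also have "\<dots> = 1 / tanh (real (2 * k) * u)"
    by (simp only: tanh_def sinh_field_def cosh_field_def p_def q_def)
  finally show ?thesis .
qed

lemma quotient_cheb_tanh:
  fixes u :: real
  shows "4 / ((((1 + tanh u) / (1 - tanh u))^k + ((1 - tanh u) / (1 + tanh u))^k)^2 - 4)
      = 1 / sinh (real (2 * k) * u)^2"
proof -
  have "(1 + tanh u) / (1 - tanh u) = exp (2 * u)" "(1 - tanh u) / (1 + tanh u) = exp (- (2 * u))"
    unfolding one_plus_minus_tanh by (simp_all flip: exp_diff)
  then have "((1 + tanh u) / (1 - tanh u))^k + ((1 - tanh u) / (1 + tanh u))^k = 2 * cosh (real (2 * k) * u)"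
    by (simp add: cosh_field_def mult_ac flip: exp_of_nat_mult)
  then show ?thesis
    by (simp add: power_mult_distrib sinh_square_eq divide_simps)
qed

lemma balance_strict_mono:
  fixes u v :: real
  assumes "k \<ge> 1" "0 < u" "u < v"
  shows "tanh u * sinh (real (4 * k) * u) < tanh v * sinh (real (4 * k) * v)"
  using assms by (intro mult_strict_mono) auto

lemma balance_exists:
  assumes "k \<ge> 1"
  shows "\<exists>u>0. tanh u * sinh (real (4 * k) * u) = 4 * real k"
proof -
  \<comment> \<open>Since \<open>sinh w \<ge> w\<close>, the balance is exceeded as soon as \<open>v tanh v \<ge> 1\<close>; this holds
    here because \<open>v \<ge> 1\<close> gives \<open>tanh v \<ge> tanh 1\<close>.\<close>
  define v :: real where "v = 1 / tanh 1"
  have t1: "0 < tanh (1::real)" by simp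
  have v: "1 \<le> v" using t1 tanh_real_lt_1[of 1] by (simp add: v_def field_simps)
  have "4 * real k = tanh 1 * (real (4 * k) * v)" by (simp add: v_def)
  also have "\<dots> \<le> tanh v * sinh (real (4 * k) * v)"
    using v t1 real_le_x_sinh[of "real (4 * k) * v"]
    by (intro mult_mono) (auto simp: sinh_field_def exp_minus)
  finally have "\<exists>u\<ge>0. u \<le> v \<and> tanh u * sinh (real (4 * k) * u) = 4 * real k"
    using v by (intro IVT') (auto intro!: continuous_intros)
  then obtain u where u: "u \<ge> 0" "tanh u * sinh (real (4 * k) * u) = 4 * real k" by auto
  with assms have "u \<noteq> 0" by auto
  with u show ?thesis by (intro exI[of _ u]) auto
qed

lemma tanh_surj_unit:
  fixes x :: real
  assumes "0 < x" "x < 1"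
  obtains u where "0 < u" "x = tanh u"
proof -
  have "tanh (artanh x) = x"
  proof -
    define y where "y = (1 + x) / (1 - x)"
    have y: "0 < y" "1 - x \<noteq> 0" using assms by (auto simp: y_def)
    have "tanh (ln y / 2) = tanh (ln (sqrt y))" using y by (simp add: ln_sqrt)
    also have "\<dots> = (y - 1) / (y + 1)" using y by (simp add: tanh_ln_real)
    also have "\<dots> = (2 * x / (1 - x)) / (2 / (1 - x))"
    proof -
      have "y - 1 = 2 * x / (1 - x)" "y + 1 = 2 / (1 - x)"
        using y(2) by (simp_all add: y_def field_simps)
      then show ?thesis by simp
    qed
    also have "\<dots> = x" using y(2) by simp
    finally show ?thesis by (simp add: artanh_def y_def)
  qed
  moreover from this have "0 < artanh x"
    using assms tanh_real_pos_iff[of "artanh x"] by simp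
  ultimately show thesis using that[of "artanh x"] by simp
qed

theorem mainTheorem2:
  fixes k :: nat
  assumes "k \<ge> 1"
  shows "\<exists>a\<in>{0<..<1::real}.
    (\<forall>b\<in>{0<..<1::real}.
       sqrt b / (2 * real k) *
         (((1 + sqrt b)^(2*k) + (1 - sqrt b)^(2*k)) / ((1 + sqrt b)^(2*k) - (1 - sqrt b)^(2*k)))
       = 4 / ((((1 + sqrt b) / (1 - sqrt b))^k + ((1 - sqrt b) / (1 + sqrt b))^k)^2 - 4)
       \<longleftrightarrow> b = a) \<and>
    is_arg_min (worst_case k) (\<lambda>b. b \<in> {0..<1}) a \<and>
    (\<forall>x\<in>{0<..<1::real}.
       8 * real k * (1 - x^2)^(2*k) + x * ((1 - x)^(4*k) - (1 + x)^(4*k)) = 0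
       \<longleftrightarrow> x = sqrt a)"
proof -
  obtain u where u: "0 < u" and bal: "tanh u * sinh (real (4 * k) * u) = 4 * real k"
    using balance_exists[OF assms] by blast
  have uniq: "tanh v * sinh (real (4 * k) * v) = 4 * real k \<longleftrightarrow> v = u" if "0 < v" for v
    using balance_strict_mono[OF assms u, of v] balance_strict_mono[OF assms that, of u] bal
    by (cases v u rule: linorder_cases) auto
  define a where "a = tanh u ^ 2"
  have sq: "sqrt (tanh v ^ 2) = tanh v" if "0 < v" for v :: real
    using that by simp
  have sqrt_tanh: "\<exists>v>0. b = tanh v ^ 2" if "b \<in> {0<..<1}" for b :: real
  proof -
    have "0 < sqrt b" "sqrt b < 1" using that by auto
    then obtain v where "0 < v" "sqrt b = tanh v" by (rule tanh_surj_unit)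
    moreover have "b = sqrt b ^ 2" using that by simp
    ultimately show ?thesis by auto
  qed
  have a: "a \<in> {0<..<1}"
    using u tanh_real_lt_1[of u] by (auto simp: a_def power_less_one_iff abs_square_less_1)
  let ?E = "tanh u / (2 * real k * tanh (real (2 * k) * u))"
  have cross: "?E = 1 / sinh (real (2 * k) * u)^2"
    using crossing_iff_balance[OF assms u] bal by blast
  have value_a: "worst_case k a \<le> ereal ?E"
    using worst_case_le[OF assms u] cross by (simp add: a_def)
  have min: "worst_case k a \<le> worst_case k b" if b: "b \<in> {0..<1}" for b
  proof (cases "b = 0")
    case True
    then show ?thesis by (simp add: worst_case_zero)
  next
    case False
    then obtain v where v: "0 < v" "b = tanh v ^ 2" using sqrt_tanh[of b] b by auto
    show ?thesis
    proof (cases "u \<le> v")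
      case True
      have "?E \<le> tanh v / (2 * real k * tanh (real (2 * k) * v))"
        using divide_right_mono[OF tanh_quotient_mono[OF u True, of "2 * k"], of "2 * real k"]
        by (simp add: mult_ac)
      then have "ereal ?E \<le> ereal (tanh v / (2 * real k * tanh (real (2 * k) * v)))" by simp
      with value_a worst_case_ge_origin[OF assms v(1)] show ?thesis
        unfolding v(2) by (meson order_trans)
    next
      case False
      then have "sinh (real (2 * k) * v) \<le> sinh (real (2 * k) * u)"
        by (simp add: mult_left_mono)
      then have "?E \<le> 1 / sinh (real (2 * k) * v)^2"
        unfolding cross using v assms by (intro divide_left_mono power_mono) auto
      then have "ereal ?E \<le> ereal (1 / sinh (real (2 * k) * v)^2)" by simp
      with value_a worst_case_ge_endpoint[OF assms v(1)] show ?thesis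
        unfolding v(2) by (meson order_trans)
    qed
  qed
  show ?thesis
  proof (intro bexI[of _ a] conjI ballI)
    fix b :: real assume "b \<in> {0<..<1}"
    then obtain v where v: "0 < v" "b = tanh v ^ 2" using sqrt_tanh by blast
    have "b = a \<longleftrightarrow> v = u"
      using v u sq by (metis a_def tanh_real_eq_iff)
    then show "sqrt b / (2 * real k) *
         (((1 + sqrt b)^(2*k) + (1 - sqrt b)^(2*k)) / ((1 + sqrt b)^(2*k) - (1 - sqrt b)^(2*k)))
       = 4 / ((((1 + sqrt b) / (1 - sqrt b))^k + ((1 - sqrt b) / (1 + sqrt b))^k)^2 - 4)
       \<longleftrightarrow> b = a"
      using crossing_iff_balance[OF assms v(1)] uniq[OF v(1)]
      unfolding v(2) sq[OF v(1)] quotient_power_tanh quotient_cheb_tanh by simp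
  next
    show "is_arg_min (worst_case k) (\<lambda>b. b \<in> {0..<1}) a"
      unfolding is_arg_min_def
    proof (intro conjI notI)
      show "a \<in> {0..<1}" using a by simp
      assume "\<exists>b. b \<in> {0..<1} \<and> worst_case k b < worst_case k a"
      then obtain b where "b \<in> {0..<1}" "worst_case k b < worst_case k a" by blast
      with min[of b] show False by (simp add: leD)
    qed
  next
    fix x :: real assume "x \<in> {0<..<1}"
    then obtain v where v: "0 < v" "x = tanh v" using tanh_surj_unit[of x] by auto
    show "8 * real k * (1 - x^2)^(2*k) + x * ((1 - x)^(4*k) - (1 + x)^(4*k)) = 0
       \<longleftrightarrow> x = sqrt a"
      unfolding v(2) polynomial_iff_balance uniq[OF v(1)] a_def sq[OF u] by simp
  qed (rule a)
qed

end
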